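(* Let $n\ge 7$ and let $A_n$ be the alternating group on $n$ letters. Then the difference graph $\mathcal{D}(A_n)$ is a cograph if and only if $n=7$.
   Context: Difference graph: for a finite group $G$, the power graph $\mathcal{P}(G)$ is the simple undirected graph with vertex set $G$ in which distinct $a,b$ are adjacent iff $a\in\langle b\rangle$ or $b\in\langle a\rangle$. The enhanced power graph $\mathcal{P}_E(G)$ is the simple undirected graph with vertex set $G$ in which distinct $a,b$ are adjacent iff $a,b\in\langle c\rangle$ for some $c\in G$. The difference graph $\mathcal{D}(G)$ is obtained from the graph $\mathcal{P}_E(G)-\mathcal{P}(G)$ (vertex set $G$; two vertices are adjacent iff they are adjacent in $\mathcal{P}_E(G)$ but not in $\mathcal{P}(G)$) by removing all isolated vertices. A graph is a cograph if it has no induced subgraph isomorphic to the path $P_4$ on 4 vertices. *)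

theory Defs
  imports "HOL-Algebra.Sym_Groups" "Graph_Theory.Digraph_Isomorphism"
begin

text \<open>
  Simple undirected graphs are rendered, as in the Graph Theory library, by symmetric loop-free
  digraphs without parallel arcs (locale \<open>pair_graph\<close>): the undirected edge between \<open>a\<close> and \<open>b\<close>
  is the pair of arcs \<open>(a, b)\<close>, \<open>(b, a)\<close>.
\<close>

definition power_graph :: "('a, 'm) monoid_scheme \<Rightarrow> 'a pair_pre_digraph" where
  "power_graph G = \<lparr> pverts = carrier G,
     parcs = {(a, b). a \<in> carrier G \<and> b \<in> carrier G \<and> a \<noteq> b \<and>
                      (a \<in> generate G {b} \<or> b \<in> generate G {a})} \<rparr>"

definition enhanced_power_graph :: "('a, 'm) monoid_scheme \<Rightarrow> 'a pair_pre_digraph" where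
  "enhanced_power_graph G = \<lparr> pverts = carrier G,
     parcs = {(a, b). a \<in> carrier G \<and> b \<in> carrier G \<and> a \<noteq> b \<and>
                      (\<exists>c\<in>carrier G. a \<in> generate G {c} \<and> b \<in> generate G {c})} \<rparr>"

definition edge_difference :: "'a pair_pre_digraph \<Rightarrow> 'a pair_pre_digraph \<Rightarrow> 'a pair_pre_digraph" where
  "edge_difference X Y = \<lparr> pverts = pverts X, parcs = parcs X - parcs Y \<rparr>"

definition isolated_vertex :: "'a pair_pre_digraph \<Rightarrow> 'a \<Rightarrow> bool" where
  "isolated_vertex X v \<longleftrightarrow> v \<in> pverts X \<and> (\<forall>w. (v, w) \<notin> parcs X \<and> (w, v) \<notin> parcs X)"

definition remove_isolated :: "'a pair_pre_digraph \<Rightarrow> 'a pair_pre_digraph" where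
  "remove_isolated X = \<lparr> pverts = {v \<in> pverts X. \<not> isolated_vertex X v}, parcs = parcs X \<rparr>"

definition difference_graph :: "('a, 'm) monoid_scheme \<Rightarrow> 'a pair_pre_digraph" where
  "difference_graph G = remove_isolated (edge_difference (enhanced_power_graph G) (power_graph G))"

text \<open>The path on \<open>k\<close> vertices.\<close>

definition path_graph :: "nat \<Rightarrow> nat pair_pre_digraph" where
  "path_graph k = \<lparr> pverts = {..<k},
     parcs = {(i, j). i < k \<and> j < k \<and> (j = Suc i \<or> i = Suc j)} \<rparr>"

definition cograph :: "'a pair_pre_digraph \<Rightarrow> bool" where
  "cograph X \<longleftrightarrow>
     \<not> (\<exists>H :: 'a pair_pre_digraph. induced_subgraph H X \<and> digraph_iso H (path_graph 4))"

text \<open>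
  The library's \<open>induced_subgraph H X\<close> includes well-formedness of \<open>X\<close>, so \<open>cograph\<close> is only
  meaningful for well-formed graphs; the graphs above are indeed finite simple graphs.
\<close>

lemma pair_graph_path_graph: "pair_graph (path_graph k)"
proof unfold_locales
  have "parcs (path_graph k) \<subseteq> {..<k} \<times> {..<k}"
    by (auto simp: path_graph_def)
  then show "finite (parcs (path_graph k))"
    by (rule finite_subset) simp
qed (auto simp: path_graph_def symmetric_def sym_def)

lemma pair_graph_difference_graph:
  assumes "finite (carrier G)"
  shows "pair_graph (difference_graph G)"
proof unfold_locales
  have "parcs (difference_graph G) \<subseteq> carrier G \<times> carrier G"
    by (auto simp: difference_graph_def remove_isolated_def edge_difference_def
        enhanced_power_graph_def)
  then show "finite (parcs (difference_graph G))"
    by (rule finite_subset) (simp add: assms)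
qed (use assms in \<open>auto simp: difference_graph_def remove_isolated_def edge_difference_def
        isolated_vertex_def enhanced_power_graph_def power_graph_def symmetric_def sym_def\<close>)

end

theory Submission
  imports Defs "HOL-Algebra.Multiplicative_Group" "HOL-Computational_Algebra.Primes"
begin

text \<open>
  Two vertices of the difference graph that are joined by an arc lie in a common cyclic subgroup
  \<open>\<langle>c\<rangle>\<close>, and a cyclic group of prime power order contributes no arc because its subgroups form
  a chain. In \<open>A\<^sub>7\<close> this leaves only \<open>c\<close> of cycle type 3 2 2, so that every arc joins a
  3-cycle with a double transposition whose support is complementary. Walking along a path
  \<open>a, b, c, d\<close>, the support alternates between a set and its complement, and hence \<open>a\<close> and \<open>d\<close>
  are adjacent. For \<open>n \<ge> 8\<close> the permutations (1 2)(3 4), (5 6 7), (1 2)(3 8), (4 5 6) form an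
  induced path: consecutive ones commute and have coprime orders, whereas the other pairs do
  not commute.
\<close>

section \<open>Induced paths on four vertices\<close>

text \<open>Replaces isomorphisms by a condition on arcs alone. Distinctness of the four vertices
  comes for free: any coincidence would produce a loop or turn one of the three path arcs into one
  of the excluded chords.\<close>

lemma cograph_iff:
  assumes "pair_graph X"
  shows "cograph X \<longleftrightarrow>
    (\<forall>a b c d. (a, b) \<in> parcs X \<longrightarrow> (b, c) \<in> parcs X \<longrightarrow> (c, d) \<in> parcs X \<longrightarrow>
       (a, c) \<in> parcs X \<or> (b, d) \<in> parcs X \<or> (a, d) \<in> parcs X)" (is "_ \<longleftrightarrow> ?R")
proof -
  interpret pair_graph X by fact
  have sym: "(y, x) \<in> parcs X" if "(x, y) \<in> parcs X" for x y
    using that arcs_symmetric by blast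
  have irrefl: "(x, x) \<notin> parcs X" for x
    using no_loops' by fastforce
  have inX: "x \<in> pverts X" "y \<in> pverts X" if "(x, y) \<in> parcs X" for x y
    using that wellformed by fastforce+
  have less4: "{..<4::nat} = {0, 1, 2, 3}"
    by auto
  have "\<not> ?R" if "\<not> cograph X"
  proof -
    from that obtain H :: "'a pair_pre_digraph" and f
      where H: "induced_subgraph H X"
        and f: "pre_digraph.digraph_isomorphism H f"
        and img: "with_proj (path_graph 4) = app_iso f H"
      unfolding cograph_def digraph_iso_def by blast
    have verts: "iso_verts f ` pverts H = {..<4}"
      using arg_cong[OF img, of verts] by (simp add: path_graph_def)
    have arcs: "iso_arcs f ` parcs H = parcs (path_graph 4)"
      using arg_cong[OF img, of arcs] by simp
    \<comment> \<open>Both graphs are pair digraphs, so comparing their tail and head maps forces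
      \<open>f\<close> to act on an arc through its two end points; \<open>iso_arcs f\<close> is
      then determined by \<open>iso_verts f\<close>.\<close>
    have ends: "iso_tail f = fst" "iso_head f = snd"
      using arg_cong[OF img, of tail] arg_cong[OF img, of head] by simp_all
    have inj: "inj_on (iso_verts f) (pverts H)"
      using f by (simp add: pre_digraph.digraph_isomorphism_def)
    have arc_f: "iso_arcs f (u, v) = (iso_verts f u, iso_verts f v)" if "(u, v) \<in> parcs H" for u v
      using f that ends by (force simp: pre_digraph.digraph_isomorphism_def prod_eq_iff)
    have parcs_H: "parcs H = {e \<in> parcs X. fst e \<in> pverts H \<and> snd e \<in> pverts H}"
      using H by (simp add: induced_subgraph_def)
    have arc_iff: "(u, v) \<in> parcs X \<longleftrightarrow> (iso_verts f u, iso_verts f v) \<in> parcs (path_graph 4)"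
      if "u \<in> pverts H" "v \<in> pverts H" for u v
    proof
      assume "(u, v) \<in> parcs X"
      then have "(u, v) \<in> parcs H"
        using that parcs_H by simp
      then show "(iso_verts f u, iso_verts f v) \<in> parcs (path_graph 4)"
        using arcs arc_f by (metis imageI)
    next
      assume "(iso_verts f u, iso_verts f v) \<in> parcs (path_graph 4)"
      then obtain e where "e \<in> parcs H" "iso_arcs f e = (iso_verts f u, iso_verts f v)"
        using arcs by (metis imageE)
      then obtain u' v' where "(u', v') \<in> parcs H" "iso_verts f u' = iso_verts f u"
        "iso_verts f v' = iso_verts f v"
        using arc_f by (cases e) auto
      then show "(u, v) \<in> parcs X"
        using inj that parcs_H by (auto dest: inj_onD)
    qed
    obtain a b c d where v: "a \<in> pverts H" "b \<in> pverts H" "c \<in> pverts H" "d \<in> pverts H"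
      and fv: "iso_verts f a = 0" "iso_verts f b = 1" "iso_verts f c = 2" "iso_verts f d = 3"
    proof -
      have "\<exists>x\<in>pverts H. iso_verts f x = i" if "i < 4" for i
        using verts that by (metis imageE lessThan_iff)
      from this[of 0] this[of 1] this[of 2] this[of 3] show ?thesis
        using that by auto
    qed
    show "\<not> ?R"
    proof
      assume ?R
      moreover have "(a, b) \<in> parcs X" "(b, c) \<in> parcs X" "(c, d) \<in> parcs X"
        "(a, c) \<notin> parcs X" "(b, d) \<notin> parcs X" "(a, d) \<notin> parcs X"
        using v by (simp_all add: arc_iff fv path_graph_def)
      ultimately show False
        by blast
    qed
  qed
  moreover have "\<not> cograph X" if "\<not> ?R"
  proof -
    from that obtain a b c d
      where arcs: "(a, b) \<in> parcs X" "(b, c) \<in> parcs X" "(c, d) \<in> parcs X"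
        and nonarcs: "(a, c) \<notin> parcs X" "(b, d) \<notin> parcs X" "(a, d) \<notin> parcs X"
      by blast
    have dist: "a \<noteq> b" "a \<noteq> c" "a \<noteq> d" "b \<noteq> c" "b \<noteq> d" "c \<noteq> d"
      using arcs nonarcs irrefl sym by blast+
    define E where "E = {(a, b), (b, a), (b, c), (c, b), (c, d), (d, c)}"
    define H where "H = \<lparr> pverts = {a, b, c, d}, parcs = E \<rparr>"
    define g :: "'a \<Rightarrow> nat" where
      "g x = (if x = a then 0 else if x = b then 1 else if x = c then 2 else 3)" for x
    have g [simp]: "g a = 0" "g b = 1" "g c = 2" "g d = 3"
      using dist by (auto simp: g_def)
    define f where "f = \<lparr> iso_verts = g, iso_arcs = map_prod g g, iso_head = snd, iso_tail = fst \<rparr>"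
    \<comment> \<open>The explicit list in \<open>E\<close> serves the isomorphism with the path;
      the same set as the full restriction of the arcs of \<open>X\<close> is what makes
      \<open>H\<close> induced.\<close>
    have E: "E = {e \<in> parcs X. fst e \<in> {a, b, c, d} \<and> snd e \<in> {a, b, c, d}}"
    proof (rule Set.set_eqI)
      fix e :: "'a \<times> 'a"
      obtain x y where e: "e = (x, y)"
        by fastforce
      have "(b, a) \<in> parcs X" "(c, b) \<in> parcs X" "(d, c) \<in> parcs X"
        "(c, a) \<notin> parcs X" "(d, b) \<notin> parcs X" "(d, a) \<notin> parcs X"
        using arcs nonarcs sym by blast+
      then show "e \<in> E \<longleftrightarrow> e \<in> {e \<in> parcs X. fst e \<in> {a, b, c, d} \<and> snd e \<in> {a, b, c, d}}"
        using arcs nonarcs irrefl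
        unfolding E_def e mem_Collect_eq fst_conv snd_conv insert_iff empty_iff simp_thms prod.inject
        by metis
    qed
    have wf: "wf_digraph (with_proj H)"
      by unfold_locales (auto simp: H_def E_def)
    have "induced_subgraph H X"
      unfolding induced_subgraph_def subgraph_def
      using arcs inX E wf wf_digraph by (auto simp: H_def compatible_def)
    moreover have "digraph_iso H (path_graph 4)"
      unfolding digraph_iso_def
    proof (intro exI conjI)
      have inj: "inj_on g {a, b, c, d}"
        using dist by (auto simp: inj_on_def)
      moreover have "inj_on (map_prod g g) E"
        by (rule inj_on_subset[OF map_prod_inj_on[OF inj inj]]) (auto simp: E_def)
      ultimately show "pre_digraph.digraph_isomorphism H f"
        using wf by (auto simp: pre_digraph.digraph_isomorphism_def f_def H_def)
      have "g ` {a, b, c, d} = {..<4}"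
        unfolding less4 by simp
      moreover have "map_prod g g ` E = parcs (path_graph 4)"
        unfolding E_def path_graph_def by auto
      ultimately show "with_proj (path_graph 4) = app_iso f H"
        by (simp add: with_proj_def app_iso_def f_def H_def path_graph_def)
    qed
    ultimately show ?thesis
      unfolding cograph_def by blast
  qed
  ultimately show ?thesis
    by blast
qed

section \<open>Arcs of the difference graph\<close>

text \<open>Deleting isolated vertices removes no arc. The condition that \<open>a\<close> and
  \<open>b\<close> differ is absorbed by the non-memberships, as every element lies in the subgroup
  that it generates.\<close>

lemma (in group) difference_graph_arc_iff:
  "(a, b) \<in> parcs (difference_graph G) \<longleftrightarrow>
     a \<in> carrier G \<and> b \<in> carrier G \<and>
     (\<exists>c\<in>carrier G. a \<in> generate G {c} \<and> b \<in> generate G {c}) \<and>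
     a \<notin> generate G {b} \<and> b \<notin> generate G {a}"
  using generate.incl[of a "{a}" G]
  by (auto simp: difference_graph_def remove_isolated_def edge_difference_def
      enhanced_power_graph_def power_graph_def)

lemma (in group) generate_singleton_commute:
  assumes "c \<in> carrier G" "a \<in> generate G {c}" "b \<in> generate G {c}"
  shows "a \<otimes> b = b \<otimes> a"
  using assms by (auto simp: generate_pow int_pow_mult[symmetric] add.commute)

text \<open>The product of \<open>a\<close> and \<open>b\<close> generates a cyclic subgroup
  containing both. Neither is a power of the other, since its order would then divide both
  \<open>p\<close> and \<open>q\<close>.\<close>

lemma (in group) difference_graph_arc_coprime:
  assumes fin: "finite (carrier G)" and a: "a \<in> carrier G" and b: "b \<in> carrier G"
    and comm: "a \<otimes> b = b \<otimes> a"
    and pow: "a [^] p = \<one>" "b [^] q = \<one>" and "coprime p (q :: nat)"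
    and "a \<noteq> \<one>" "b \<noteq> \<one>"
  shows "(a, b) \<in> parcs (difference_graph G)"
proof -
  have *: "x \<in> generate G {x \<otimes> y} \<and> x \<notin> generate G {y}"
    if x: "x \<in> carrier G" and y: "y \<in> carrier G" and comm: "x \<otimes> y = y \<otimes> x"
      and pow: "x [^] p = \<one>" "y [^] q = \<one>" and co: "coprime p q" and ne: "x \<noteq> \<one>"
    for x y and p q :: nat
  proof
    \<comment> \<open>Raising the product to the power \<open>v * q\<close> kills \<open>y\<close>
      and leaves x^(1 - u * p) = x.\<close>
    obtain u v where uv: "u * int p + v * int q = 1"
      using bezout_int[of "int p" "int q"] co by (metis coprime_imp_gcd_eq_1 coprime_int_iff)
    have "(x \<otimes> y) [^] (v * int q) = x [^] (v * int q) \<otimes> y [^] (int q * v)"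
      using int_pow_mult_distrib[OF comm x y] by (simp add: mult.commute)
    also have "y [^] (int q * v) = \<one>"
      using pow y by (simp add: int_pow_int flip: int_pow_pow)
    also have "x [^] (v * int q) \<otimes> \<one> = x [^] (int p * u) \<otimes> x [^] (v * int q)"
      using pow x by (simp add: int_pow_int flip: int_pow_pow)
    also have "\<dots> = x"
      using uv x by (simp add: mult.commute flip: int_pow_mult)
    finally show "x \<in> generate G {x \<otimes> y}"
      using generate_pow[of "x \<otimes> y"] x y by auto metis
    show "x \<notin> generate G {y}"
    proof
      assume "x \<in> generate G {y}"
      then obtain m :: nat where "x = y [^] m"
        using generate_pow_on_finite_carrier[OF fin y] by auto
      then have "x [^] q = \<one>"
        using pow(2) y by (metis nat_pow_one nat_pow_pow mult.commute)
      then have "ord x dvd gcd p q"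
        using pow x pow_eq_id by simp
      then show False
        using co x ne ord_eq_1 by simp
    qed
  qed
  show ?thesis
    unfolding difference_graph_arc_iff
    using *[OF a b comm pow] *[OF b a comm[symmetric] pow(2,1)] assms
    by (metis coprime_commute m_closed)
qed

text \<open>By Bezout, the gcd of \<open>i\<close> and \<open>N\<close> is a multiple of
  \<open>i\<close> modulo \<open>N\<close>, so the power of \<open>c\<close> with that exponent
  already lies in the subgroup generated by c^i. Any \<open>N\<close> annihilating \<open>c\<close>
  will do; it need not be the order.\<close>

lemma (in group) pow_mem_generate_pow:
  assumes c: "c \<in> carrier G" and N: "c [^] (N :: nat) = \<one>" and dvd: "gcd i N dvd j"
  shows "c [^] (j :: nat) \<in> generate G {c [^] (i :: nat)}"
proof -
  have "gcd (int i) (int N) dvd int j"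
    using dvd by (metis gcd_int_int_eq int_dvd_int_iff)
  then obtain m where m: "int j = gcd (int i) (int N) * m" ..
  obtain u v where uv: "u * int i + v * int N = gcd (int i) (int N)"
    using bezout_int by blast
  have "int j = int i * (u * m) + int N * (v * m)"
    unfolding m uv[symmetric] by (simp add: algebra_simps)
  then have "c [^] j = c [^] (int i * (u * m) + int N * (v * m))"
    by (metis int_pow_int)
  also have "\<dots> = (c [^] i) [^] (u * m) \<otimes> (c [^] N) [^] (v * m)"
    using c by (simp add: int_pow_mult int_pow_pow flip: int_pow_int)
  finally have "c [^] j = (c [^] i) [^] (u * m)"
    using c N by simp
  then show ?thesis
    using generate_pow[of "c [^] i"] c by auto
qed

text \<open>The gcds of the two exponents with p^k are powers of \<open>p\<close>, and of two such
  powers one divides the other.\<close>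

lemma (in group) generate_prime_power_linear:
  assumes fin: "finite (carrier G)" and c: "c \<in> carrier G" and "prime p"
    and N: "c [^] (p ^ k :: nat) = \<one>"
    and "a \<in> generate G {c}" "b \<in> generate G {c}"
  shows "a \<in> generate G {b} \<or> b \<in> generate G {a}"
proof -
  obtain i j :: nat where ij: "a = c [^] i" "b = c [^] j"
    using assms generate_pow_on_finite_carrier[OF fin c] by auto
  obtain u v where uv: "gcd i (p ^ k) = p ^ u" "gcd j (p ^ k) = p ^ v"
    using \<open>prime p\<close> divides_primepow_nat by (metis gcd_dvd2)
  show ?thesis
  proof (cases "u \<le> v")
    case True
    then have "gcd i (p ^ k) dvd j"
      using uv by (metis dvd_trans gcd_dvd1 le_imp_power_dvd)
    then show ?thesis
      using pow_mem_generate_pow[OF c N] ij by blast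
  next
    case False
    then have "gcd j (p ^ k) dvd i"
      using uv by (metis dvd_trans gcd_dvd1 le_imp_power_dvd nle_le)
    then show ?thesis
      using pow_mem_generate_pow[OF c N] ij by blast
  qed
qed

section \<open>Cycle partition of a permutation\<close>

text \<open>A cycle of length m is a product of m - 1 transpositions, peeled off one at a time. The
  empty list must be excluded: it has even length but yields the identity, which is even.\<close>

lemma evenperm_cycle_of_list:
  assumes "distinct cs" "cs \<noteq> []"
  shows "evenperm (cycle_of_list cs) \<longleftrightarrow> odd (length cs)"
  using assms
proof (induction cs rule: cycle_of_list.induct)
  case (1 i j cs)
  then show ?case
    by (simp add: evenperm_comp permutation_swap_id permutation_of_cycle evenperm_swap del: o_apply)
qed (simp_all add: evenperm_id)

text \<open>The k-th power of the cycle rotates the list by \<open>k\<close>, so it shifts positions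
  by \<open>k\<close> modulo the length.\<close>

lemma cycle_of_list_funpow_eq_iff:
  assumes "distinct cs" "x \<in> set cs"
  shows "(cycle_of_list cs ^^ k) x = x \<longleftrightarrow> length cs dvd k"
proof -
  obtain i where i: "i < length cs" "x = cs ! i"
    using assms by (metis in_set_conv_nth)
  have "(cycle_of_list cs ^^ k) x = rotate k cs ! i"
    using cyclic_rotation[OF assms(1), of k] i by (metis nth_map)
  also have "\<dots> = cs ! ((k + i) mod length cs)"
    using i by (simp add: nth_rotate)
  finally have "(cycle_of_list cs ^^ k) x = x \<longleftrightarrow> (k + i) mod length cs = i"
    using i assms by (metis length_pos_if_in_set mod_less_divisor nth_eq_iff_index_eq)
  also have "\<dots> \<longleftrightarrow> (k + i) mod length cs = (0 + i) mod length cs"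
    using i by simp
  also have "\<dots> \<longleftrightarrow> length cs dvd k"
    by (metis add_diff_cancel_right' le_add2 mod_eq_dvd_iff_nat add_0)
  finally show ?thesis .
qed

lemma permutes_disjoint_commute:
  assumes "p permutes S" "q permutes T" "S \<inter> T = {}"
  shows "p \<circ> q = q \<circ> p"
proof
  fix x
  show "(p \<circ> q) x = (q \<circ> p) x"
  proof (cases "x \<in> S")
    case True
    then have "x \<notin> T" "p x \<notin> T"
      using assms permutes_in_image[OF assms(1)] by blast+
    then show ?thesis
      using assms by (simp add: permutes_not_in)
  next
    case False
    then have "q x \<notin> S"
      using assms by (cases "x \<in> T") (auto simp: permutes_in_image permutes_not_in)
    with False show ?thesis
      using assms by (simp add: permutes_not_in)
  qed
qed

lemma funpow_comp_commute:
  assumes "p \<circ> q = q \<circ> p"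
  shows "(p \<circ> q) ^^ k = (p ^^ k) \<circ> (q ^^ k)"
proof (induction k)
  case (Suc k)
  have "q \<circ> p ^^ k = p ^^ k \<circ> q"
    using assms by (induction k) (simp_all add: fun_eq_iff, metis)
  then show ?case
    using Suc by (simp add: fun_eq_iff)
qed simp

text \<open>The blocks are the supports of the cycles, fixed points being blocks of size one. A
  permutation has the parity of the number of points minus the number of cycles; the sum has the
  same parity and avoids truncated subtraction.\<close>

lemma cycle_decomp_partition:
  assumes "cycle_decomp I p"
  shows "finite I \<and> p permutes I \<and> (\<exists>P. partition_on I P \<and>
    (\<forall>X\<in>P. \<forall>x\<in>X. \<forall>k. (p ^^ k) x = x \<longleftrightarrow> card X dvd k) \<and>
    (evenperm p \<longleftrightarrow> even (card I + card P)))"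
  using assms
proof induction
  case empty
  show ?case
    by (auto simp: partition_on_empty evenperm_id permutes_id)
next
  case (comp I p cs)
  then obtain P where P: "partition_on I P"
    and cyc: "\<And>X x k. X \<in> P \<Longrightarrow> x \<in> X \<Longrightarrow> (p ^^ k) x = x \<longleftrightarrow> card X dvd k"
    and ev: "evenperm p \<longleftrightarrow> even (card I + card P)"
    and I: "finite I" "p permutes I"
    by blast
  let ?q = "cycle_of_list cs \<circ> p"
  have fin: "finite (set cs \<union> I)"
    using I by simp
  have perm: "?q permutes (set cs \<union> I)"
    using I(2) cycle_permutes[of cs]
    by (meson permutes_compose permutes_subset sup_ge1 sup_ge2)
  show ?case
  \<comment> \<open>A cycle decomposition may contain empty cycles. These change neither the
    permutation nor its domain, and the empty set must not become a block.\<close>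
  proof (cases "cs = []")
    case True
    then show ?thesis
      using I P cyc ev by auto
  next
    case False
    have pow: "?q ^^ k = (cycle_of_list cs ^^ k) \<circ> (p ^^ k)" for k
      using permutes_disjoint_commute[OF cycle_permutes I(2) comp.hyps(3)] funpow_comp_commute by metis
    have fixI: "(cycle_of_list cs ^^ k) x = x" if "x \<in> I" for k x
      using that comp.hyps(3) permutes_funpow[OF cycle_permutes] by (meson disjoint_iff permutes_not_in)
    have fixcs: "(p ^^ k) x = x" if "x \<in> set cs" for k x
      using that comp.hyps(3) permutes_funpow[OF I(2)] by (meson disjoint_iff permutes_not_in)
    have "partition_on (set cs \<union> I) (insert (set cs) P)"
      using P comp.hyps(3) False by (auto simp: partition_on_def disjoint_def)
    moreover have "(?q ^^ k) x = x \<longleftrightarrow> card X dvd k" if X: "X \<in> insert (set cs) P" "x \<in> X" for X x k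
    proof (cases "X = set cs")
      case True
      then show ?thesis
        using X comp.hyps(2)
        by (simp add: pow fixcs cycle_of_list_funpow_eq_iff distinct_card)
    next
      case False
      then have "X \<in> P"
        using X by simp
      then have "(p ^^ k) x \<in> I"
        using X P permutes_in_image[OF permutes_funpow[OF I(2)]] by (auto simp: partition_on_def)
      then show ?thesis
        using \<open>X \<in> P\<close> X by (simp add: pow fixI cyc)
    qed
    moreover have "evenperm ?q \<longleftrightarrow> even (card (set cs \<union> I) + card (insert (set cs) P))"
    proof -
      \<comment> \<open>The new block is not yet in \<open>P\<close>, so the number of blocks grows
        by exactly one.\<close>
      have "set cs \<notin> P"
        using False comp.hyps(3) partition_onD1[OF P] by (metis Int_absorb2 Union_upper set_empty)
      moreover have "finite P"
        using P I finite_elements by blast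
      moreover have "card (set cs \<union> I) = length cs + card I"
        using comp.hyps I by (simp add: card_Un_disjoint distinct_card)
      moreover have "evenperm ?q \<longleftrightarrow> (evenperm (cycle_of_list cs) \<longleftrightarrow> evenperm p)"
        using I by (intro evenperm_comp permutation_of_cycle) (auto simp: permutation_permutes)
      ultimately show ?thesis
        using evenperm_cycle_of_list[OF comp.hyps(2) False] ev by auto
    qed
    ultimately show ?thesis
      using fin perm by blast
  qed
qed

lemma even_permutation_partition:
  assumes "p permutes S" "finite S" "evenperm p"
  obtains P where "partition_on S P" "even (card S + card P)"
    "\<And>X x k. X \<in> P \<Longrightarrow> x \<in> X \<Longrightarrow> (p ^^ k) x = x \<longleftrightarrow> card X dvd k"
  using cycle_decomp_partition[OF cycle_decomposition[OF assms(1,2)]] assms(3) by blast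

section \<open>The alternating groups\<close>

lemma alt_group_finite: "finite (carrier (alt_group n))"
  by (rule finite_subset[OF _ finite_permutations[of "{1..n}"]]) (auto simp: alt_group_carrier)

lemma alt_group_pow: "p [^]\<^bsub>alt_group n\<^esub> (k :: nat) = p ^^ k"
proof (induction k)
  case 0
  show ?case
    by (simp add: alt_group_one)
next
  case (Suc k)
  then show ?case
    by (simp add: alt_group_mult funpow_swap1 fun_eq_iff)
qed

lemma alt_group_generate:
  assumes "c \<in> carrier (alt_group n)"
  shows "generate (alt_group n) {c} = range (\<lambda>k. c ^^ k)"
proof -
  interpret group "alt_group n"
    by (rule alt_group_is_group)
  show ?thesis
    using generate_pow_on_finite_carrier[OF alt_group_finite assms] by (auto simp: alt_group_pow)
qed

lemma alt_group_arc_involution_order3: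
  assumes "a \<in> carrier (alt_group n)" "b \<in> carrier (alt_group n)" "a \<circ> b = b \<circ> a"
    and "a ^^ 2 = id" "b ^^ 3 = id" "a \<noteq> id" "b \<noteq> id"
  shows "(a, b) \<in> parcs (difference_graph (alt_group n))"
proof -
  interpret group "alt_group n"
    by (rule alt_group_is_group)
  show ?thesis
    using assms by (intro difference_graph_arc_coprime[where p = 2 and q = 3] alt_group_finite)
      (simp_all add: alt_group_pow alt_group_mult alt_group_one)
qed

text \<open>Used in contrapositive form to establish non-adjacency.\<close>

lemma alt_group_arc_commute:
  assumes "(a, b) \<in> parcs (difference_graph (alt_group n))"
  shows "a \<circ> b = b \<circ> a"
proof -
  interpret group "alt_group n"
    by (rule alt_group_is_group)
  show ?thesis
    using assms generate_singleton_commute by (auto simp: difference_graph_arc_iff alt_group_mult)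
qed

lemma alt_group_arc_sym:
  assumes "(a, b) \<in> parcs (difference_graph (alt_group n))"
  shows "(b, a) \<in> parcs (difference_graph (alt_group n))"
proof -
  interpret group "alt_group n"
    by (rule alt_group_is_group)
  show ?thesis
    using assms by (auto simp: difference_graph_arc_iff)
qed

section \<open>Degree at least eight: an induced path\<close>

lemma alt_group_not_cograph:
  assumes "n \<ge> 8"
  shows "\<not> cograph (difference_graph (alt_group n))"
proof -
  let ?E = "parcs (difference_graph (alt_group n))"
  let ?t = "\<lambda>i j. transpose (i :: nat) j"
  have carrier: "?t i j \<circ> ?t k l \<in> carrier (alt_group n)"
    if "i \<noteq> j" "k \<noteq> l" "{i, j, k, l} \<subseteq> {1..n}" for i j k l
    using that by (auto simp: alt_group_carrier evenperm_comp permutation_swap_id evenperm_swap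
        intro!: permutes_compose permutes_swap_id)
  have arc: "(?t i j \<circ> ?t k l, ?t p q \<circ> ?t q r) \<in> ?E"
    if dist: "distinct [i, j, k, l, p, q, r]" and sub: "{i, j, k, l, p, q, r} \<subseteq> {1..n}"
    for i j k l p q r
  proof (rule alt_group_arc_involution_order3)
    show "?t i j \<circ> ?t k l \<in> carrier (alt_group n)" "?t p q \<circ> ?t q r \<in> carrier (alt_group n)"
      using dist sub by (auto intro!: carrier)
    have "?t i j \<circ> ?t k l permutes {i, j, k, l}" "?t p q \<circ> ?t q r permutes {p, q, r}"
      by (auto intro!: permutes_compose permutes_swap_id)
    then show "(?t i j \<circ> ?t k l) \<circ> (?t p q \<circ> ?t q r) = (?t p q \<circ> ?t q r) \<circ> (?t i j \<circ> ?t k l)"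
      using dist by (intro permutes_disjoint_commute) auto
    show "(?t i j \<circ> ?t k l) ^^ 2 = id"
      using dist by (auto simp: numeral_2_eq_2 fun_eq_iff transpose_def)
    show "(?t p q \<circ> ?t q r) ^^ 3 = id"
      using dist by (auto simp: numeral_3_eq_3 fun_eq_iff transpose_def)
    have "(?t i j \<circ> ?t k l) i = j" "(?t p q \<circ> ?t q r) r = p" "j \<noteq> i" "p \<noteq> r"
      using dist by (auto simp: transpose_def)
    then show "?t i j \<circ> ?t k l \<noteq> id" "?t p q \<circ> ?t q r \<noteq> id"
      by (metis id_apply)+
  qed
  \<comment> \<open>The two 3-cycles together move 4, 5, 6, 7. The support of \<open>?c\<close> must
    avoid these points to be disjoint from both, which takes the four letters 1, 2, 3, 8; here the
    eighth letter enters.\<close>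
  let ?a = "?t 1 2 \<circ> ?t 3 4" and ?b = "?t 5 6 \<circ> ?t 6 7"
    and ?c = "?t 1 2 \<circ> ?t 3 8" and ?d = "?t 4 5 \<circ> ?t 5 6"
  \<comment> \<open>The middle arc is reversed because \<open>arc\<close> puts the double
    transposition first.\<close>
  have "(?a, ?b) \<in> ?E" "(?c, ?b) \<in> ?E" "(?c, ?d) \<in> ?E"
    using assms by (intro arc; simp)+
  then have "(?a, ?b) \<in> ?E" "(?b, ?c) \<in> ?E" "(?c, ?d) \<in> ?E"
    using alt_group_arc_sym by blast+
  moreover have "(?a \<circ> ?c) 3 \<noteq> (?c \<circ> ?a) 3" "(?b \<circ> ?d) 4 \<noteq> (?d \<circ> ?b) 4"
    "(?a \<circ> ?d) 3 \<noteq> (?d \<circ> ?a) 3"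
    by (simp_all add: transpose_def)
  then have "(?a, ?c) \<notin> ?E" "(?b, ?d) \<notin> ?E" "(?a, ?d) \<notin> ?E"
    using alt_group_arc_commute by metis+
  ultimately show ?thesis
    using cograph_iff[OF pair_graph_difference_graph[OF alt_group_finite]] by blast
qed

section \<open>Degree seven: cycle types, arcs and the cograph property\<close>

text \<open>The cycle types of even permutations of seven points are 7, 5 1 1, 4 2 1, 3 3 1, 3 2 2,
  3 1 1 1 1, 2 2 1 1 1 and 1 1 1 1 1 1 1; all of them except 3 2 2 have prime power order.\<close>

lemma odd_partition_of_seven:
  assumes P: "partition_on S P" and S: "card S = 7" and odd: "odd (card P)"
  obtains p k where "prime p" "\<And>X. X \<in> P \<Longrightarrow> card X dvd p ^ k"
  | X Y Z where "P = {X, Y, Z}" "card X = 3" "card Y = 2" "card Z = 2"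
proof -
  have finS: "finite S"
    using S card.infinite by fastforce
  have finP: "finite P"
    using finite_elements[OF finS P] .
  have pos: "card X \<ge> 1" if "X \<in> P" for X
    using that P finS by (metis One_nat_def Suc_leI card_gt_0_iff finite_subset partition_onD1
        partition_onD3 Union_upper)
  have "card S = (\<Sum>X\<in>P. card X)"
    using P finS by (metis card_Union_disjoint finite_subset partition_onD1 partition_onD2
        pairwise_def disjnt_def Union_upper disjoint_def)
  \<comment> \<open>The excess of a block is its size minus one, and the excesses add up to 7 minus
    the number of blocks. With 1, 3, 5 or 7 blocks, only 6, 4, 2 or 0 remains to be
    distributed.\<close>
  also have "\<dots> = (\<Sum>X\<in>P. (card X - 1) + 1)"
    by (intro sum.cong refl) (metis pos le_add_diff_inverse2)
  also have "\<dots> = (\<Sum>X\<in>P. card X - 1) + card P"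
    by (simp only: sum.distrib card_eq_sum)
  finally have excess: "(\<Sum>X\<in>P. card X - 1) + card P = 7"
    using S by simp
  have le: "card X - 1 \<le> 7 - card P" if "X \<in> P" for X
    using member_le_sum[OF that, of "\<lambda>X. card X - 1"] finP excess by simp
  have "card P \<le> 7"
    using excess by linarith
  then have "card P = 1 \<or> card P = 3 \<or> card P = 5 \<or> card P = 7"
    using odd by presburger
  then consider "card P = 1" | "card P = 3" | "card P = 5" | "card P = 7"
    by blast
  then show ?thesis
  proof cases
    case 1
    then obtain X where "P = {X}"
      by (rule card_1_singletonE)
    moreover from this have "card X = 7"
      using excess by simp
    ultimately show ?thesis
      by (intro that(1)[of 7 1]) auto
  next
    case 2
    then obtain X Y Z where XYZ: "P = {X, Y, Z}" "X \<noteq> Y" "Y \<noteq> Z" "X \<noteq> Z"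
      by (auto simp: card_3_iff)
    have "card X \<ge> 1" "card Y \<ge> 1" "card Z \<ge> 1"
      using pos XYZ by auto
    moreover have "card X - 1 + (card Y - 1) + (card Z - 1) = 4"
      using excess XYZ by simp
    ultimately have "card X + card Y + card Z = 7"
      "card X \<in> {1, 2, 3, 4, 5}" "card Y \<in> {1, 2, 3, 4, 5}"
      "card Z \<in> {1, 2, 3, 4, 5}"
      by auto
    \<comment> \<open>The first three alternatives cover 5 1 1, 4 2 1 and 3 3 1; the last three are
      3 2 2, according to which block has size 3.\<close>
    then consider "\<forall>W\<in>P. card W dvd 5 ^ 1" | "\<forall>W\<in>P. card W dvd 2 ^ 2" | "\<forall>W\<in>P. card W dvd 3 ^ 1"
      | "card X = 3 \<and> card Y = 2 \<and> card Z = 2"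
      | "card Y = 3 \<and> card X = 2 \<and> card Z = 2"
      | "card Z = 3 \<and> card X = 2 \<and> card Y = 2"
      unfolding XYZ(1) by auto
    then show ?thesis
    proof cases
      case 1
      then show ?thesis
        by (intro that(1)[of 5 1]) auto
    next
      case 2
      then show ?thesis
        by (intro that(1)[of 2 2]) auto
    next
      case 3
      then show ?thesis
        by (intro that(1)[of 3 1]) auto
    next
      case 4
      then show ?thesis
        using XYZ by (intro that(2)[of X Y Z]) auto
    next
      case 5
      then show ?thesis
        using XYZ by (intro that(2)[of Y X Z]) auto
    next
      case 6
      then show ?thesis
        using XYZ by (intro that(2)[of Z X Y]) auto
    qed
  next
    case 3
    show ?thesis
    \<comment> \<open>The total excess is 2: a block of size 3 uses all of it, and otherwise no
      block exceeds size 2.\<close>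
    proof (cases "\<exists>X\<in>P. card X = 3")
      case True
      then obtain X where X: "X \<in> P" "card X = 3"
        by blast
      have "(\<Sum>Y\<in>P - {X}. card Y - 1) = 0"
        using excess 3 X sum.remove[OF finP X(1), of "\<lambda>Y. card Y - 1"] by simp
      then have "card Y \<le> 1" if "Y \<in> P" "Y \<noteq> X" for Y
        using that finP by simp
      then have "card Y = 1" if "Y \<in> P" "Y \<noteq> X" for Y
        using that pos[OF that(1)] le_antisym by blast
      then have "card Y dvd 3 ^ 1" if "Y \<in> P" for Y
        using that X(2) by (cases "Y = X") simp_all
      then show ?thesis
        by (intro that(1)[of 3 1]) auto
    next
      case False
      then have "card X = 1 \<or> card X = 2" if "X \<in> P" for X
        using that le[OF that] pos[OF that] 3 by force
      then have "card X dvd 2 ^ 1" if "X \<in> P" for X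
        using that by fastforce
      then show ?thesis
        by (intro that(1)[of 2 1]) auto
    qed
  next
    case 4
    then have "card X = 1" if "X \<in> P" for X
      using le[OF that] pos[OF that] by simp
    then show ?thesis
      by (intro that(1)[of 2 0]) auto
  qed
qed

text \<open>A common generator \<open>c\<close> of prime power order would make \<open>a\<close> and
  \<open>b\<close> comparable, so \<open>c\<close> has type 3 2 2 and order 6. Incomparable elements
  of a cyclic group of order 6 have orders 2 and 3: one is a power of \<open>c\<close> moving just
  the 3-block, the other a power moving just the two 2-blocks.\<close>

lemma alt_group_7_arc:
  assumes "(a, b) \<in> parcs (difference_graph (alt_group 7))"
  obtains X where "X \<subseteq> {1..7}" "card X = 3"
    "{x. a x \<noteq> x} = X \<and> a ^^ 3 = id \<and> {x. b x \<noteq> x} = {1..7} - X \<and> b ^^ 2 = id \<or>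
     {x. b x \<noteq> x} = X \<and> b ^^ 3 = id \<and> {x. a x \<noteq> x} = {1..7} - X \<and> a ^^ 2 = id"
proof -
  interpret group "alt_group 7"
    by (rule alt_group_is_group)
  obtain c where c: "c \<in> carrier (alt_group 7)"
    and gen: "a \<in> generate (alt_group 7) {c}" "b \<in> generate (alt_group 7) {c}"
    and incomp: "a \<notin> generate (alt_group 7) {b}" "b \<notin> generate (alt_group 7) {a}"
    using assms by (auto simp: difference_graph_arc_iff)
  have perm: "c permutes {1..7}" and "evenperm c"
    using c by (auto simp: alt_group_carrier)
  then obtain P where P: "partition_on {1..7} P" and "even (card {1..7::nat} + card P)"
    and cyc: "\<And>X x k. X \<in> P \<Longrightarrow> x \<in> X \<Longrightarrow> (c ^^ k) x = x \<longleftrightarrow> card X dvd k"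
    using even_permutation_partition[of c "{1..7}"] by blast
  then have "odd (card P)"
    by simp
  have outside: "(c ^^ k) x = x" if "x \<notin> {1..7}" for k x
    using permutes_not_in[OF permutes_funpow[OF perm] that] .
  have inside: "\<exists>X\<in>P. x \<in> X" if "x \<in> {1..7}" for x
    using that partition_onD1[OF P] by blast
  have pow_id: "c ^^ k = id" if "\<And>X. X \<in> P \<Longrightarrow> card X dvd k" for k
  proof
    fix x
    show "(c ^^ k) x = id x"
      using that cyc inside[of x] outside[of x k] by (cases "x \<in> {1..7}") auto
  qed
  show ?thesis
  proof (rule odd_partition_of_seven[OF P _ \<open>odd (card P)\<close>])
    show "card {1..7::nat} = 7"
      by simp
  next
    fix p k
    assume "prime p" and dvd: "\<And>X. X \<in> P \<Longrightarrow> card X dvd p ^ k"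
    then have "c [^]\<^bsub>alt_group 7\<^esub> (p ^ k) = \<one>\<^bsub>alt_group 7\<^esub>"
      using pow_id by (simp add: alt_group_pow alt_group_one)
    then show thesis
      using generate_prime_power_linear[OF alt_group_finite c \<open>prime p\<close> _ gen] incomp by blast
  next
    fix X Y Z
    assume XYZ: "P = {X, Y, Z}" "card X = 3" "card Y = 2" "card Z = 2"
    have X: "X \<subseteq> {1..7}" and union: "X \<union> (Y \<union> Z) = {1..7}"
      using partition_onD1[OF P] XYZ by auto
    \<comment> \<open>Both 2-blocks impose the same condition, so only membership in
      \<open>X\<close> matters; outside {1..7} both implications are vacuous.\<close>
    have fixed_iff: "(c ^^ k) x = x \<longleftrightarrow> (x \<in> X \<longrightarrow> 3 dvd k) \<and> (x \<in> {1..7} - X \<longrightarrow> 2 dvd k)" for k x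
    proof (cases "x \<in> {1..7}")
      case True
      then consider "x \<in> X" | "x \<in> Y" "x \<notin> X" | "x \<in> Z" "x \<notin> X"
        using union by blast
      then show ?thesis
        using True cyc[of X x k] cyc[of Y x k] cyc[of Z x k] XYZ by cases simp_all
    next
      case False
      then show ?thesis
        using outside X by auto
    qed
    have supp3: "{x. (c ^^ k) x \<noteq> x} = X" if "gcd k 6 = 2" for k
    proof -
      have "2 dvd k"
        using that by (metis gcd_dvd1)
      moreover have "\<not> 3 dvd k"
      proof
        assume "3 dvd k"
        then have "3 dvd gcd k 6"
          by (intro gcd_greatest) auto
        then show False
          using that by simp
      qed
      ultimately show ?thesis
        by (simp add: fixed_iff)
    qed
    have supp2: "{x. (c ^^ k) x \<noteq> x} = {1..7} - X" if "gcd k 6 = 3" for k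
    proof -
      have "3 dvd k"
        using that by (metis gcd_dvd1)
      moreover have "\<not> 2 dvd k"
      proof
        assume "2 dvd k"
        then have "2 dvd gcd k 6"
          by (intro gcd_greatest) auto
        then show False
          using that by simp
      qed
      ultimately show ?thesis
        by (auto simp: fixed_iff)
    qed
    have c6: "c ^^ 6 = id"
      using XYZ by (intro pow_id) auto
    have order: "(c ^^ k) ^^ m = id" if "6 dvd k * m" for k m
      using that c6 by (metis dvdE funpow_mult id_funpow mult.commute)
    obtain i j where ij: "a = c ^^ i" "b = c ^^ j"
      using gen alt_group_generate[OF c] by auto
    have ndvd: "\<not> gcd i 6 dvd j" "\<not> gcd j 6 dvd i"
      using pow_mem_generate_pow[OF c, of 6] c6 incomp ij by (auto simp: alt_group_pow alt_group_one)
    have dvd6: "d = 1 \<or> d = 2 \<or> d = 3 \<or> d = 6" if "d dvd 6" for d :: nat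
    proof -
      have "d \<le> 6"
        using that by (simp add: dvd_imp_le)
      then have "d = 0 \<or> d = 1 \<or> d = 2 \<or> d = 3 \<or> d = 4 \<or> d = 5 \<or> d = 6"
        by linarith
      then show ?thesis
        using that by auto
    qed
    \<comment> \<open>By \<open>ndvd\<close>, neither gcd with 6 divides the other exponent. A gcd
      of 1 divides everything, a gcd of 6 makes the exponent a multiple of the other gcd, and equal
      gcds divide both exponents; only 2 and 3 are left.\<close>
    have "gcd i 6 \<noteq> 1" "gcd j 6 \<noteq> 1"
      using ndvd by (metis one_dvd)+
    moreover have "gcd i 6 \<noteq> 6" "gcd j 6 \<noteq> 6"
      using ndvd by (metis dvd_trans gcd_dvd1 gcd_dvd2)+
    moreover have "gcd i 6 \<noteq> gcd j 6"
      using ndvd by (metis gcd_dvd1)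
    ultimately consider "gcd i 6 = 2" "gcd j 6 = 3" | "gcd i 6 = 3" "gcd j 6 = 2"
      using dvd6[OF gcd_dvd2, of i] dvd6[OF gcd_dvd2, of j] by linarith
    then show thesis
    proof cases
      case 1
      then have "2 dvd i" "3 dvd j"
        by (metis gcd_dvd1)+
      then have "a ^^ 3 = id" "b ^^ 2 = id"
        unfolding ij by (auto intro!: order elim!: dvdE)
      then show thesis
        using that[of X] X XYZ supp3[OF 1(1)] supp2[OF 1(2)] unfolding ij by blast
    next
      case 2
      then have "3 dvd i" "2 dvd j"
        by (metis gcd_dvd1)+
      then have "a ^^ 2 = id" "b ^^ 3 = id"
        unfolding ij by (auto intro!: order elim!: dvdE)
      then show thesis
        using that[of X] X XYZ supp2[OF 2(1)] supp3[OF 2(2)] unfolding ij by blast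
    qed
  qed
qed

lemma alt_group_7_cograph: "cograph (difference_graph (alt_group 7))"
proof -
  let ?E = "parcs (difference_graph (alt_group 7))"
  define T where "T X p \<longleftrightarrow> {x. p x \<noteq> x} = X \<and> card X = 3 \<and> p ^^ 3 = id" for X :: "nat set" and p
  \<comment> \<open>\<open>D\<close> is indexed by the complement of the support, so that the two
    ends of an arc carry the same label \<open>X\<close>.\<close>
  define D where "D X p \<longleftrightarrow> {x. p x \<noteq> x} = {1..7} - X \<and> X \<subseteq> {1..7} \<and> card X = 3 \<and> p ^^ 2 = id"
    for X :: "nat set" and p
  have arc: "\<exists>X. T X a \<and> D X b \<or> T X b \<and> D X a" if "(a, b) \<in> ?E" for a b
    by (rule alt_group_7_arc[OF that]) (auto simp: T_def D_def)
  \<comment> \<open>The supports have 3 and 4 points respectively.\<close>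
  have not_both: False if "T X p" "D Y p" for X Y p
  proof -
    have "card ({1..7} - Y) = 4"
      using that by (subst card_Diff_subset) (auto simp: D_def intro: finite_subset)
    then show False
      using that by (simp add: T_def D_def)
  qed
  have T_unique: "X = Y" if "T X p" "T Y p" for X Y p
    using that by (simp add: T_def)
  have D_unique: "X = Y" if "D X p" "D Y p" for X Y p
    using that unfolding D_def by blast
  have carrier: "a \<in> carrier (alt_group 7)" "b \<in> carrier (alt_group 7)" if "(a, b) \<in> ?E" for a b
    using that group.difference_graph_arc_iff[OF alt_group_is_group] by blast+
  have supp_permutes: "p permutes {x. p x \<noteq> x}" if "p \<in> carrier (alt_group 7)" for p
    using that by (auto simp: alt_group_carrier intro: permutes_superset)
  \<comment> \<open>Converse to \<open>arc\<close>: all vertices of opposite kinds with the same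
    label are adjacent.\<close>
  have join: "(p, q) \<in> ?E" if "T X p" "D X q" "p \<in> carrier (alt_group 7)" "q \<in> carrier (alt_group 7)"
    for X p q
  proof -
    have "q \<circ> p = p \<circ> q"
      using that by (intro permutes_disjoint_commute[OF supp_permutes supp_permutes])
        (auto simp: T_def D_def)
    moreover have "p \<noteq> id"
      using that(1) by (auto simp: T_def)
    moreover have "q \<noteq> id"
    proof
      assume "q = id"
      then have "{1..7} \<subseteq> X"
        using that(2) by (auto simp: D_def)
      then have "X = {1..7}"
        using that(2) by (simp add: D_def)
      then show False
        using that(1) by (simp add: T_def)
    qed
    ultimately have "(q, p) \<in> ?E"
      using that by (intro alt_group_arc_involution_order3) (auto simp: T_def D_def)
    then show ?thesis
      by (rule alt_group_arc_sym)
  qed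
  have "(a, d) \<in> ?E" if path: "(a, b) \<in> ?E" "(b, c) \<in> ?E" "(c, d) \<in> ?E" for a b c d
  proof -
    obtain X where "T X a \<and> D X b \<or> T X b \<and> D X a"
      using arc[OF path(1)] by blast
    \<comment> \<open>Each of the three arcs switches the kind and keeps the label, so the end
      points have opposite kinds.\<close>
    then have "T X a \<and> D X d \<or> T X d \<and> D X a"
      using arc[OF path(2)] arc[OF path(3)] not_both T_unique D_unique by metis
    then show ?thesis
      using join alt_group_arc_sym carrier path by blast
  qed
  then show ?thesis
    using cograph_iff[OF pair_graph_difference_graph[OF alt_group_finite]] by blast
qed

theorem theorem5p6:
  fixes n :: nat
  assumes "n \<ge> 7"
  shows "cograph (difference_graph (alt_group n)) \<longleftrightarrow> n = 7"
proof (cases "n = 7")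
  case True
  then show ?thesis
    using alt_group_7_cograph by simp
next
  case False
  then show ?thesis
    using assms alt_group_not_cograph by simp
qed

end
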